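(* In the setting described in the context, let $y\in\mathcal R(A)$ and $u^\dagger:=A^{-1}y$. Suppose that: (i) there is a constant $C<\infty$ with $$\sup_{i\in\mathbb N}\frac{|(y,\underline y^i)|}{|(y^i,\underline y^i)|}\leq C;$$ (ii) the training inputs satisfy $$\sum_{i=1}^\infty|(u^i,\overline u^i)|<\infty;$$ (iii) there is a constant $C'>0$ such that for every $n\in\mathbb N$ and every $i\geq n+1$ the coefficients $\beta_j^{i,n}$ of the expansion $P_{\mathcal Y_n}\overline y^i=\sum_{j=1}^n\beta_j^{i,n}\,\overline y^j$ satisfy $\sum_{j=1}^n(\beta_j^{i,n})^2\leq C'$ (with $C'$ independent of $i$ and $n$). Then $u_n^{\mathcal U}:=A^{-1}P_{\mathcal Y_n}y$ converges strongly (in the norm of $\mathcal U$) to $u^\dagger$ as $n\to\infty$.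
   Context: $\mathcal U$ and $\mathcal Y$ are separable real Hilbert spaces and $A\colon\mathcal U\to\mathcal Y$ is a bounded linear injective operator whose inverse $A^{-1}\colon\mathcal R(A)\to\mathcal U$ is unbounded. The training pairs $\{u^i,y^i\}_{i\in\mathbb N}\subset\mathcal U\times\mathcal Y$ satisfy $Au^i=y^i$ for all $i$; for every $n$ the inputs $u^1,\dots,u^n$ are linearly independent; $\|u^i\|=1$ for all $i$; and $\overline{\bigcup_{n}\mathcal U_n}=\mathcal U$ (closure), where $\mathcal U_n:=\mathrm{Span}\{u^1,\dots,u^n\}$. Further $\mathcal Y_n:=\mathrm{Span}\{y^1,\dots,y^n\}\subset\mathcal R(A)$, and $P_{\mathcal Y_n}$ denotes the orthogonal projection onto $\mathcal Y_n$. Two orthonormalisations are used. (1) $\{\overline u^i\}_{i\in\mathbb N}$ is the orthonormal basis of $\mathcal U$ obtained by applying the Gram-Schmidt process to $\{u^i\}_{i\in\mathbb N}$, and $\overline y^i:=A\overline u^i$, so that $\{\overline y^i\}_{i=1,\dots,n}$ is a (generally non-orthogonal) basis of $\mathcal Y_n$. (2) $\{\underline y^i\}_{i\in\mathbb N}$ is the orthonormal sequence obtained by applying the Gram-Schmidt process to $\{y^i\}_{i\in\mathbb N}$, i.e. $\underline y^i=(y^i-P_{\mathcal Y_{i-1}}y^i)/\|y^i-P_{\mathcal Y_{i-1}}y^i\|$ with $\mathcal Y_0:=\{0\}$; in particular $(y^i,\underline y^i)\neq0$. *)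

theory Defs
  imports "HOL-Analysis.Analysis"
begin

text \<open>
  The description operator is meaningful only when the projection exists, for instance when
  \<open>S\<close> is the span of a finite set; see \<open>orth_proj_span\<close> and \<open>orth_proj_unique\<close> below.
  (The library constant \<^const>\<open>closest_point\<close> needs the Heine-Borel property, hence finite dimension.)
\<close>

definition orth_proj :: "'a::real_inner set \<Rightarrow> 'a \<Rightarrow> 'a" where
  "orth_proj S x = (THE p. p \<in> S \<and> (\<forall>v\<in>S. orthogonal (x - p) v))"

text \<open>
  Gram-Schmidt applied to a sequence \<open>x 1, x 2, \<dots>\<close>. Sequences are indexed from 1 and the value
  \<open>x 0\<close> is never used for indices \<open>i \<ge> 1\<close>; \<open>x ` {1..<1}\<close> is empty and its span is \<open>{0}\<close>.
\<close>

definition gram_schmidt :: "(nat \<Rightarrow> 'a::real_inner) \<Rightarrow> nat \<Rightarrow> 'a" where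
  "gram_schmidt x i =
     (x i - orth_proj (span (x ` {1..<i})) (x i)) /\<^sub>R
       norm (x i - orth_proj (span (x ` {1..<i})) (x i))"

lemma orth_proj_span_exists:
  fixes B :: "'a::real_inner set"
  assumes "finite B"
  shows "\<exists>p\<in>span B. \<forall>v\<in>span B. orthogonal (x - p) v"
  using assms
proof (induction B arbitrary: x rule: finite_induct)
  case empty
  then show ?case by (simp add: orthogonal_def)
next
  case (insert b B)
  obtain p where p: "p \<in> span B" "\<And>v. v \<in> span B \<Longrightarrow> (x - p) \<bullet> v = 0"
    using insert.IH[of x] by (auto simp: orthogonal_def)
  obtain q where q: "q \<in> span B" "\<And>v. v \<in> span B \<Longrightarrow> (b - q) \<bullet> v = 0"
    using insert.IH[of b] by (auto simp: orthogonal_def)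
  define w where "w = b - q"
  define c where "c = (x \<bullet> w) / (w \<bullet> w)"
  have sub: "span B \<subseteq> span (insert b B)"
    by (rule span_mono) auto
  have pw: "p \<bullet> w = 0"
    using q(2)[OF p(1)] by (simp add: w_def inner_commute)
  have mem: "p + c *\<^sub>R w \<in> span (insert b B)"
    unfolding w_def using p(1) q(1) sub
    by (intro span_add span_scale span_diff) (auto intro: span_base)
  have "(x - (p + c *\<^sub>R w)) \<bullet> v = 0" if v: "v \<in> span (insert b B)" for v
  proof -
    obtain k where "v - k *\<^sub>R b \<in> span B"
      using v by (auto simp: span_insert)
    then have "(v - k *\<^sub>R b) + k *\<^sub>R q \<in> span B"
      using q(1) by (intro span_add span_scale)
    then obtain s where s: "s \<in> span B" and veq: "v = s + k *\<^sub>R w"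
      by (auto simp: w_def algebra_simps)
    have "(x - (p + c *\<^sub>R w)) \<bullet> s = 0"
      using p(2)[OF s] q(2)[OF s] by (simp add: w_def[symmetric] inner_diff_left inner_add_left)
    moreover have "(x - (p + c *\<^sub>R w)) \<bullet> w = 0"
      using pw by (simp add: c_def inner_diff_left inner_add_left)
    ultimately show ?thesis
      by (simp add: veq inner_add_right)
  qed
  with mem show ?case by (auto simp: orthogonal_def)
qed

lemma orth_proj_unique:
  fixes B :: "'a::real_inner set"
  assumes p: "p \<in> span B" "\<forall>v\<in>span B. orthogonal (x - p) v"
    and q: "q \<in> span B" "\<forall>v\<in>span B. orthogonal (x - q) v"
  shows "p = q"
proof -
  have "p - q \<in> span B" using p(1) q(1) by (rule span_diff)
  then have "(x - p) \<bullet> (p - q) = 0" "(x - q) \<bullet> (p - q) = 0"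
    using p(2) q(2) by (auto simp: orthogonal_def)
  then have "(p - q) \<bullet> (p - q) = 0"
    by (simp add: inner_diff_left)
  then show ?thesis by simp
qed

lemma orth_proj_span:
  fixes B :: "'a::real_inner set"
  assumes "finite B"
  shows "orth_proj (span B) x \<in> span B"
    and "v \<in> span B \<Longrightarrow> orthogonal (x - orth_proj (span B) x) v"
proof -
  have "\<exists>!p. p \<in> span B \<and> (\<forall>v\<in>span B. orthogonal (x - p) v)"
    using orth_proj_span_exists[OF assms, of x] orth_proj_unique[of _ B x] by blast
  from theI'[OF this] show "orth_proj (span B) x \<in> span B"
    and "v \<in> span B \<Longrightarrow> orthogonal (x - orth_proj (span B) x) v"
    by (auto simp: orth_proj_def)
qed

end

theory Submission
  imports Defs
begin

text \<open>
  Write \<open>P n\<close> for the orthogonal projection onto the span of \<open>ys 1, \<dots>, ys n\<close>. Passing from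
  \<open>P (n - 1)\<close> to \<open>P n\<close> adds one Gram-Schmidt component, \<open>(y \<bullet> g) g\<close> with
  \<open>g = gram_schmidt ys n\<close> (\<open>orth_proj_span_step\<close>). The vector \<open>g\<close> is a multiple of the residual
  \<open>ys n - P (n - 1) (ys n)\<close>, and a residual is blind to changes inside the span. Since \<open>us n\<close>
  differs from \<open>(us n \<bullet> e) e\<close>, with \<open>e = gram_schmidt us n\<close>, only by an element of the span of the
  earlier inputs, that residual is \<open>us n \<bullet> e\<close> times the residual of \<open>A e\<close>. The projection of
  \<open>A e\<close> has known coefficients in the vectors \<open>A (gram_schmidt us j)\<close>, so the increment can be
  pulled back through \<open>A\<close> by hand, although the inverse is unbounded: it becomes
  \<open>(y \<bullet> g) / (ys n \<bullet> g)\<close> times \<open>us n \<bullet> e\<close> times a vector of norm at most \<open>1 + sqrt C'\<close>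
  (\<open>orth_proj_step_preimage\<close>, \<open>norm_diff_sum_gram_schmidt_le\<close>).

  The bounds on these three factors make the increments of the approximations absolutely summable, and by
  completeness the approximations converge (\<open>Cauchy_if_summable_increments\<close>). Their images are the
  projections of \<open>y\<close>, which tend to \<open>y\<close> because the inputs span a dense subspace
  (\<open>orth_proj_span_tendsto\<close>). Continuity and injectivity of \<open>A\<close> identify the limit.
\<close>

section \<open>Orthogonal projection onto the span of a finite set\<close>

lemma orth_proj_span_eqI:
  fixes B :: "'a::real_inner set"
  assumes "finite B" and "p \<in> span B" and "\<And>v. v \<in> span B \<Longrightarrow> (x - p) \<bullet> v = 0"
  shows "orth_proj (span B) x = p"
  by (rule orth_proj_unique[of _ B x])
    (use assms orth_proj_span[OF assms(1)] in \<open>auto simp: orthogonal_def\<close>)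

lemma inner_residual_span:
  fixes B :: "'a::real_inner set"
  assumes "finite B" and "v \<in> span B"
  shows "(x - orth_proj (span B) x) \<bullet> v = 0"
  using orth_proj_span(2)[OF assms] by (simp add: orthogonal_def)

lemma residual_scaleR_add_span:
  fixes B :: "'a::real_inner set"
  assumes "finite B" and "v \<in> span B"
  shows "(c *\<^sub>R x + v) - orth_proj (span B) (c *\<^sub>R x + v)
    = c *\<^sub>R (x - orth_proj (span B) x)"
proof -
  have "orth_proj (span B) (c *\<^sub>R x + v) = c *\<^sub>R orth_proj (span B) x + v"
  proof (rule orth_proj_span_eqI[OF assms(1)])
    show "c *\<^sub>R orth_proj (span B) x + v \<in> span B"
      using assms orth_proj_span(1) by (intro span_add span_scale) auto
    fix w assume "w \<in> span B"
    then have "(x - orth_proj (span B) x) \<bullet> w = 0"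
      by (rule inner_residual_span[OF assms(1)])
    then show "(c *\<^sub>R x + v - (c *\<^sub>R orth_proj (span B) x + v)) \<bullet> w = 0"
      by (simp add: inner_diff_left)
  qed
  then show ?thesis
    by (simp add: scaleR_diff_right)
qed

lemma norm_residual_le:
  fixes B :: "'a::real_inner set"
  assumes "finite B" and "v \<in> span B"
  shows "norm (x - orth_proj (span B) x) \<le> norm (x - v)"
proof -
  define r where "r = x - orth_proj (span B) x"
  define s where "s = orth_proj (span B) x - v"
  have "s \<in> span B"
    unfolding s_def using assms orth_proj_span(1) by (intro span_diff) auto
  then have "orthogonal r s"
    unfolding r_def orthogonal_def by (rule inner_residual_span[OF assms(1)])
  then have "(norm (r + s))\<^sup>2 = (norm r)\<^sup>2 + (norm s)\<^sup>2"
    by (rule norm_add_Pythagorean)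
  then have "(norm r)\<^sup>2 \<le> (norm (r + s))\<^sup>2"
    by simp
  moreover have "r + s = x - v"
    by (simp add: r_def s_def)
  ultimately show ?thesis
    using power2_le_imp_le[of "norm r" "norm (x - v)"] unfolding r_def by simp
qed

lemma orth_proj_span_tendsto:
  fixes B :: "nat \<Rightarrow> 'a::real_inner set"
  assumes fin: "\<And>n. finite (B n)" and mono: "\<And>m n. m \<le> n \<Longrightarrow> B m \<subseteq> B n"
    and x: "x \<in> closure (\<Union>n. span (B n))"
  shows "(\<lambda>n. orth_proj (span (B n)) x) \<longlonglongrightarrow> x"
proof (rule LIMSEQ_I)
  fix e :: real
  assume "e > 0"
  then obtain v m where v: "v \<in> span (B m)" "dist v x < e"
    using x unfolding closure_approachable by blast
  have "norm (orth_proj (span (B n)) x - x) < e" if "n \<ge> m" for n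
  proof -
    have "v \<in> span (B n)"
      using v(1) span_mono[OF mono[OF that]] by blast
    from norm_residual_le[OF fin this, of x] v(2) show ?thesis
      by (simp add: dist_norm norm_minus_commute)
  qed
  then show "\<exists>N. \<forall>n\<ge>N. norm (orth_proj (span (B n)) x - x) < e"
    by blast
qed

section \<open>Gram-Schmidt vectors\<close>

lemma gram_schmidt_residual:
  "x i - orth_proj (span (x ` {1..<i})) (x i)
    = norm (x i - orth_proj (span (x ` {1..<i})) (x i)) *\<^sub>R gram_schmidt x i"
  by (cases "norm (x i - orth_proj (span (x ` {1..<i})) (x i)) = 0")
    (simp_all add: gram_schmidt_def)

lemma inner_gram_schmidt_span:
  assumes "v \<in> span (x ` {1..<i})"
  shows "gram_schmidt x i \<bullet> v = 0"
  using inner_residual_span[OF _ assms] by (simp add: gram_schmidt_def)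

lemma inner_gram_schmidt_self:
  "x i \<bullet> gram_schmidt x i = norm (x i - orth_proj (span (x ` {1..<i})) (x i))"
proof -
  define p where "p = orth_proj (span (x ` {1..<i})) (x i)"
  have "p \<in> span (x ` {1..<i})"
    unfolding p_def by (rule orth_proj_span(1)) simp
  then have "(x i - p) \<bullet> p = 0"
    unfolding p_def by (intro inner_residual_span) auto
  then have "x i \<bullet> (x i - p) = (norm (x i - p))\<^sup>2"
    by (simp add: power2_norm_eq_inner inner_diff_left inner_diff_right inner_commute)
  then show ?thesis
    unfolding gram_schmidt_def p_def[symmetric]
    by (cases "x i = p") (simp_all add: power2_eq_square)
qed

text \<open>
  The second case occurs exactly when \<open>x i\<close> lies in the span of its predecessors.
\<close>

lemma gram_schmidt_unit_or_zero: "norm (gram_schmidt x i) = 1 \<or> gram_schmidt x i = 0"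
  by (auto simp: gram_schmidt_def)

lemma gram_schmidt_in_span:
  assumes "i \<ge> 1"
  shows "gram_schmidt x i \<in> span (x ` {1..i})"
proof -
  have "orth_proj (span (x ` {1..<i})) (x i) \<in> span (x ` {1..<i})"
    by (rule orth_proj_span(1)) simp
  moreover have "span (x ` {1..<i}) \<subseteq> span (x ` {1..i})"
    by (intro span_mono image_mono) auto
  moreover have "x i \<in> span (x ` {1..i})"
    using assms by (intro span_base imageI) auto
  ultimately show ?thesis
    unfolding gram_schmidt_def by (intro span_scale span_diff) auto
qed

lemma gram_schmidt_pairwise_orthogonal:
  assumes "i \<ge> 1" and "j \<ge> 1" and "i \<noteq> j"
  shows "gram_schmidt x i \<bullet> gram_schmidt x j = 0"
proof -
  have less: "gram_schmidt x l \<bullet> gram_schmidt x k = 0" if "1 \<le> k" "k < l" for k l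
  proof -
    have "span (x ` {1..k}) \<subseteq> span (x ` {1..<l})"
      using that by (intro span_mono image_mono) auto
    then show ?thesis
      using gram_schmidt_in_span[OF that(1), of x] by (intro inner_gram_schmidt_span) auto
  qed
  show ?thesis
    using less[of i j] less[of j i] assms by (cases "i < j") (auto simp: inner_commute)
qed

text \<open>
  The coefficients enter through their Euclidean norm alone because the Gram-Schmidt vectors
  are orthogonal; a bound by absolute values would grow with the number of terms.
\<close>

lemma norm_diff_sum_gram_schmidt_le:
  fixes b :: "nat \<Rightarrow> real"
  assumes "(\<Sum>j\<in>{1..<i}. (b j)\<^sup>2) \<le> D"
  shows "norm (gram_schmidt x i - (\<Sum>j\<in>{1..<i}. b j *\<^sub>R gram_schmidt x j)) \<le> 1 + sqrt D"
proof -
  have le1: "norm (gram_schmidt x j) \<le> 1" for j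
    using gram_schmidt_unit_or_zero[of x j] by auto
  have "(norm (\<Sum>j\<in>{1..<i}. b j *\<^sub>R gram_schmidt x j))\<^sup>2
      = (\<Sum>j\<in>{1..<i}. (norm (b j *\<^sub>R gram_schmidt x j))\<^sup>2)"
    by (rule norm_sum_Pythagorean)
      (auto simp: pairwise_def orthogonal_def gram_schmidt_pairwise_orthogonal)
  also have "\<dots> \<le> (\<Sum>j\<in>{1..<i}. (b j)\<^sup>2)"
    using le1 by (intro sum_mono) (simp add: power_mult_distrib mult_left_le power_le_one)
  also have "\<dots> \<le> D"
    by (rule assms)
  finally have "norm (\<Sum>j\<in>{1..<i}. b j *\<^sub>R gram_schmidt x j) \<le> sqrt D"
    by (rule real_le_rsqrt)
  with le1[of i] show ?thesis
    by (intro order_trans[OF norm_triangle_ineq4] add_mono)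
qed

lemma orth_proj_span_step:
  assumes "i \<ge> 1"
  shows "orth_proj (span (x ` {1..i})) y
    = orth_proj (span (x ` {1..<i})) y + (y \<bullet> gram_schmidt x i) *\<^sub>R gram_schmidt x i"
proof (rule orth_proj_span_eqI)
  define B where "B = x ` {1..<i}"
  define g where "g = gram_schmidt x i"
  define p where "p = orth_proj (span B) y"
  have B: "finite B" "x ` {1..i} = insert (x i) B"
    using assms by (auto simp: B_def atLeastLessThanSuc_atLeastAtMost[symmetric]
        atLeastLessThanSuc)
  have p: "p \<in> span B"
    unfolding p_def by (rule orth_proj_span(1)[OF B(1)])
  have g: "g \<bullet> s = 0" if "s \<in> span B" for s
    using inner_gram_schmidt_span that by (simp add: g_def B_def)
  show "finite (x ` {1..i})"
    by simp
  show "orth_proj (span (x ` {1..<i})) y + (y \<bullet> gram_schmidt x i) *\<^sub>R gram_schmidt x i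
      \<in> span (x ` {1..i})"
    using p gram_schmidt_in_span[OF assms, of x] span_mono[of B "x ` {1..i}"] B(2)
    by (intro span_add span_scale) (auto simp: p_def B_def)
  fix v assume "v \<in> span (x ` {1..i})"
  then obtain k where k: "v - k *\<^sub>R x i \<in> span B"
    unfolding B(2) span_insert by blast
  define q where "q = orth_proj (span B) (x i)"
  have "q \<in> span B"
    unfolding q_def by (rule orth_proj_span(1)[OF B(1)])
  then have s: "(v - k *\<^sub>R x i) + k *\<^sub>R q \<in> span B"
    using k by (intro span_add span_scale)
  obtain c where c: "x i - q = c *\<^sub>R g"
    using gram_schmidt_residual[of x i] by (auto simp: q_def g_def B_def)
  define w where "w = (v - k *\<^sub>R x i) + k *\<^sub>R q"
  have v: "v = w + (k * c) *\<^sub>R g"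
    using arg_cong[OF c, of "\<lambda>z. k *\<^sub>R z"] by (simp add: w_def algebra_simps)
  have "(y - p) \<bullet> w = 0"
    unfolding p_def using s by (intro inner_residual_span[OF B(1)]) (simp add: w_def)
  moreover have "g \<bullet> w = 0"
    using g s by (simp add: w_def)
  moreover have "p \<bullet> g = 0"
    using g[OF p] by (simp add: inner_commute)
  \<comment> \<open>If \<open>g = 0\<close>, then \<open>x i\<close> lies in the span of its predecessors and the projection is unchanged.\<close>
  moreover have "g = 0 \<or> g \<bullet> g = 1"
    using gram_schmidt_unit_or_zero[of x i] by (auto simp: g_def norm_eq_1)
  ultimately have "(y - (p + (y \<bullet> g) *\<^sub>R g)) \<bullet> v = 0"
    unfolding v by (auto simp: inner_diff_left inner_add_left inner_add_right)
  then show "(y - (orth_proj (span (x ` {1..<i})) y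
      + (y \<bullet> gram_schmidt x i) *\<^sub>R gram_schmidt x i)) \<bullet> v = 0"
    by (simp add: p_def g_def B_def)
qed

section \<open>Pulling the projections back through the operator\<close>

text \<open>
  Both factors come from rescaling residuals: \<open>gram_schmidt (A \<circ> u) i\<close> is the residual of
  \<open>A (u i)\<close> divided by \<open>A (u i) \<bullet> gram_schmidt (A \<circ> u) i\<close>, and the residual of \<open>A (u i)\<close> is
  \<open>u i \<bullet> gram_schmidt u i\<close> times that of \<open>A (gram_schmidt u i)\<close>.
\<close>

lemma orth_proj_step_preimage:
  fixes A :: "'u::real_inner \<Rightarrow> 'y::real_inner"
  assumes A: "linear A" and i: "i \<ge> 1"
    and w: "orth_proj (span ((A \<circ> u) ` {1..<i})) (A (gram_schmidt u i)) = A w"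
  defines "g \<equiv> gram_schmidt (A \<circ> u) i"
  shows "orth_proj (span ((A \<circ> u) ` {1..i})) y
    = orth_proj (span ((A \<circ> u) ` {1..<i})) y
      + A (((y \<bullet> g) / (A (u i) \<bullet> g) * (u i \<bullet> gram_schmidt u i)) *\<^sub>R (gram_schmidt u i - w))"
proof -
  define B where "B = (A \<circ> u) ` {1..<i}"
  define e where "e = gram_schmidt u i"
  define q where "q = orth_proj (span (u ` {1..<i})) (u i)"
  define r where "r = A (u i) - orth_proj (span B) (A (u i))"
  have fin: "finite B"
    by (simp add: B_def)
  have "q \<in> span (u ` {1..<i})"
    unfolding q_def by (rule orth_proj_span(1)) simp
  then have "A q \<in> A ` span (u ` {1..<i})"
    by (rule imageI)
  then have Aq: "A q \<in> span B"
    by (simp add: B_def linear_span_image[OF A, symmetric] image_comp)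
  have "u i = (u i \<bullet> e) *\<^sub>R e + q"
    using gram_schmidt_residual[of u i] by (simp add: e_def q_def inner_gram_schmidt_self
        algebra_simps)
  then have "A (u i) = (u i \<bullet> e) *\<^sub>R A e + A q"
    by (metis A linear_add linear_scale)
  then have "r = (u i \<bullet> e) *\<^sub>R (A e - orth_proj (span B) (A e))"
    unfolding r_def using residual_scaleR_add_span[OF fin Aq] by metis
  also have "\<dots> = A ((u i \<bullet> e) *\<^sub>R (e - w))"
    using w by (simp add: B_def e_def linear_scale[OF A] linear_diff[OF A])
  finally have r: "r = A ((u i \<bullet> e) *\<^sub>R (e - w))" .
  have "r = (A (u i) \<bullet> g) *\<^sub>R g" and "g = r /\<^sub>R (A (u i) \<bullet> g)"
    using inner_gram_schmidt_self[of "A \<circ> u" i] gram_schmidt_residual[of "A \<circ> u" i]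
    by (simp_all add: g_def r_def B_def gram_schmidt_def)
  then have "(y \<bullet> g) *\<^sub>R g = ((y \<bullet> g) / (A (u i) \<bullet> g)) *\<^sub>R r"
    by (metis divide_inverse scaleR_scaleR)
  also have "\<dots> = A (((y \<bullet> g) / (A (u i) \<bullet> g) * (u i \<bullet> e)) *\<^sub>R (e - w))"
    by (simp add: r linear_scale[OF A])
  finally show ?thesis
    using orth_proj_span_step[OF i, of "A \<circ> u" y] by (simp add: g_def e_def)
qed

section \<open>Convergence\<close>

lemma Cauchy_if_summable_increments:
  fixes X :: "nat \<Rightarrow> 'a::real_normed_vector"
  assumes inc: "\<And>n. norm (X (Suc n) - X n) \<le> b n" and "summable b"
  shows "Cauchy X"
proof (rule CauchyI')
  fix e :: real
  assume "e > 0"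
  then obtain N where N: "\<And>m n. m \<ge> N \<Longrightarrow> norm (sum b {m..<n}) < e"
    using \<open>summable b\<close> unfolding summable_Cauchy by blast
  have "dist (X m) (X n) < e" if "m \<ge> N" "n > m" for m n
  proof -
    have "norm (X n - X m) = norm (\<Sum>k\<in>{m..<n}. X (Suc k) - X k)"
      using that by (simp add: sum_Suc_diff')
    also have "\<dots> \<le> sum b {m..<n}"
      by (intro order_trans[OF norm_sum] sum_mono inc)
    also have "\<dots> < e"
      using N[OF that(1), of n] by simp
    finally show ?thesis
      by (simp add: dist_norm norm_minus_commute)
  qed
  then show "\<exists>M. \<forall>m\<ge>M. \<forall>n>m. dist (X m) (X n) < e"
    by blast
qed

theorem theorem15:
  fixes A :: "'u::{real_inner,complete_space} \<Rightarrow> 'y::{real_inner,complete_space}"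
    and us :: "nat \<Rightarrow> 'u" and ys :: "nat \<Rightarrow> 'y" and y :: 'y
    and \<beta> :: "nat \<Rightarrow> nat \<Rightarrow> nat \<Rightarrow> real" and C C' :: real
  assumes "separable_space (euclidean :: 'u topology)"
    and "separable_space (euclidean :: 'y topology)"
    and "bounded_linear A"
    and "inj A"
    and unbounded_inverse: "\<not> (\<exists>K. \<forall>z\<in>range A. norm (inv A z) \<le> K * norm z)"
    and training_pairs: "\<And>i. i \<ge> 1 \<Longrightarrow> A (us i) = ys i"
    and lin_independent: "\<And>n. inj_on us {1..n} \<and> independent (us ` {1..n})"
    and normalised: "\<And>i. i \<ge> 1 \<Longrightarrow> norm (us i) = 1"
    and dense: "closure (\<Union>n. span (us ` {1..n})) = UNIV"
    and "y \<in> range A"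
    and cond_i: "\<And>i. i \<ge> 1 \<Longrightarrow>
      \<bar>y \<bullet> gram_schmidt ys i\<bar> / \<bar>ys i \<bullet> gram_schmidt ys i\<bar> \<le> C"
    and cond_ii: "(\<lambda>i. \<bar>us i \<bullet> gram_schmidt us i\<bar>) summable_on {1..}"
    and "C' > 0"
    and cond_iii_expansion: "\<And>n i. n \<ge> 1 \<Longrightarrow> i \<ge> n + 1 \<Longrightarrow>
      orth_proj (span (ys ` {1..n})) (A (gram_schmidt us i)) =
        (\<Sum>j=1..n. \<beta> i n j *\<^sub>R A (gram_schmidt us j))"
    and cond_iii_bound: "\<And>n i. n \<ge> 1 \<Longrightarrow> i \<ge> n + 1 \<Longrightarrow>
      (\<Sum>j=1..n. (\<beta> i n j)\<^sup>2) \<le> C'"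
  shows "(\<lambda>n. inv A (orth_proj (span (ys ` {1..n})) y)) \<longlonglongrightarrow> inv A y"
proof -
  define Y where "Y n = ys ` {1..n}" for n
  define X where "X n = inv A (orth_proj (span (Y n)) y)" for n
  define e where "e = gram_schmidt us"
  define g where "g = gram_schmidt ys"
  define K where "K = C * (1 + sqrt C')"
  have lin: "linear A"
    using \<open>bounded_linear A\<close> by (rule bounded_linear.linear)
  \<comment> \<open>Nothing relates \<open>ys 0\<close> to \<open>us 0\<close>, so \<open>ys\<close> cannot be replaced by \<open>A \<circ> us\<close> outright.\<close>
  have ys_image: "(A \<circ> us) ` {1..<i} = ys ` {1..<i}" "(A \<circ> us) ` {1..i} = ys ` {1..i}" for i
    using training_pairs by (auto intro!: image_cong)
  have finY: "finite (Y n)" for n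
    by (simp add: Y_def)
  have span_Y: "span (Y n) = A ` span (us ` {1..n})" for n
    using ys_image(2)[of n] linear_span_image[OF lin, of "us ` {1..n}"]
    by (simp add: Y_def image_comp)
  have A_X: "A (X n) = orth_proj (span (Y n)) y" for n
  proof -
    have "orth_proj (span (Y n)) y \<in> range A"
      using orth_proj_span(1)[OF finY] span_Y by blast
    then show ?thesis
      by (simp add: X_def f_inv_into_f)
  qed
  have increment: "norm (X (Suc n) - X n) \<le> K * \<bar>us (Suc n) \<bullet> e (Suc n)\<bar>" for n
  proof -
    define i where "i = Suc n"
    have i: "i \<ge> 1" "{1..<i} = {1..n}" "{1..i} = {1..Suc n}"
      by (auto simp: i_def)
    define w where "w = (\<Sum>j\<in>{1..<i}. \<beta> i n j *\<^sub>R e j)"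
    define c where "c = (y \<bullet> g i) / (ys i \<bullet> g i)"
    have gs_ys: "gram_schmidt (A \<circ> us) i = g i"
      using ys_image(1)[of i] training_pairs[OF i(1)] by (simp add: g_def gram_schmidt_def)
    have w: "orth_proj (span (Y n)) (A (e i)) = A w" and w_norm: "norm (e i - w) \<le> 1 + sqrt C'"
    proof -
      show "orth_proj (span (Y n)) (A (e i)) = A w"
      proof (cases "n = 0")
        case True
        then show ?thesis
          using orth_proj_span(1)[of "{} :: 'y set"] lin
          by (simp add: w_def i_def Y_def linear_0)
      next
        case False
        then show ?thesis
          using cond_iii_expansion[of n i] i
          by (simp add: w_def Y_def e_def linear_sum[OF lin] linear_scale[OF lin])
      qed
      have "(\<Sum>j\<in>{1..<i}. (\<beta> i n j)\<^sup>2) \<le> C'"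
        using cond_iii_bound[of n i] i \<open>C' > 0\<close> by (cases "n = 0") (auto simp: i_def)
      then show "norm (e i - w) \<le> 1 + sqrt C'"
        unfolding w_def e_def by (rule norm_diff_sum_gram_schmidt_le)
    qed
    have "A (X i) = A (X n) + A ((c * (us i \<bullet> e i)) *\<^sub>R (e i - w))"
      using orth_proj_step_preimage[OF lin i(1), of us w y] w ys_image[of i] training_pairs[OF i(1)] gs_ys
      by (simp add: A_X Y_def e_def c_def i(2) i_def atLeastLessThanSuc_atLeastAtMost)
    then have "A (X i) = A (X n + (c * (us i \<bullet> e i)) *\<^sub>R (e i - w))"
      by (simp add: linear_add[OF lin])
    then have "X i - X n = (c * (us i \<bullet> e i)) *\<^sub>R (e i - w)"
      using \<open>inj A\<close> by (simp add: inj_eq)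
    then have "norm (X i - X n) = \<bar>c\<bar> * norm (e i - w) * \<bar>us i \<bullet> e i\<bar>"
      by (simp add: abs_mult)
    also have "\<dots> \<le> C * (1 + sqrt C') * \<bar>us i \<bullet> e i\<bar>"
    proof -
      have "\<bar>c\<bar> \<le> C"
        using cond_i[OF i(1)] by (simp add: c_def g_def)
      then show ?thesis
        using w_norm by (intro mult_right_mono mult_mono) auto
    qed
    finally show ?thesis
      by (simp add: K_def i_def)
  qed
  have "(\<lambda>n. \<bar>us (Suc n) \<bullet> e (Suc n)\<bar>) summable_on UNIV"
  proof -
    have "range Suc = {1..}"
      by (simp add: atLeast_Suc_greaterThan greaterThan_0)
    then show ?thesis
      using cond_ii summable_on_reindex[of Suc UNIV "\<lambda>i. \<bar>us i \<bullet> e i\<bar>"]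
      by (simp add: e_def comp_def)
  qed
  then have "summable (\<lambda>n. K * \<bar>us (Suc n) \<bullet> e (Suc n)\<bar>)"
    by (intro summable_mult) (simp add: summable_on_UNIV_nonneg_real_iff)
  with increment have "Cauchy X"
    by (rule Cauchy_if_summable_increments)
  then obtain L where L: "X \<longlonglongrightarrow> L"
    using Cauchy_convergent convergent_def by blast
  have "(\<lambda>n. A (X n)) \<longlonglongrightarrow> A L"
    using \<open>bounded_linear A\<close> L by (rule bounded_linear.tendsto)
  moreover have "(\<lambda>n. A (X n)) \<longlonglongrightarrow> y"
    unfolding A_X
  proof (rule orth_proj_span_tendsto[OF finY])
    show "Y m \<subseteq> Y n" if "m \<le> n" for m n
      using that by (auto simp: Y_def)
    have "continuous_on (closure (\<Union>n. span (us ` {1..n}))) A"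
      using \<open>bounded_linear A\<close> by (rule linear_continuous_on)
    then have "A ` closure (\<Union>n. span (us ` {1..n})) \<subseteq> closure (\<Union>n. span (Y n))"
      by (rule image_closure_subset)
        (use closure_subset[of "\<Union>n. span (Y n)"] in \<open>auto simp: span_Y\<close>)
    with dense \<open>y \<in> range A\<close> show "y \<in> closure (\<Union>n. span (Y n))"
      by auto
  qed
  ultimately have "A L = y"
    by (rule LIMSEQ_unique)
  then have "inv A y = L"
    using \<open>inj A\<close> by (auto simp: inv_f_f)
  with L show ?thesis
    by (simp add: X_def[abs_def] Y_def)
qed

end
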